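(* For every integer $s\geq 2$, \[\gamma(S(K_s^{(2)}))\geq \left(1-\frac{1}{s-1}\right)\left(1-\frac{2}{s-1}\right),\] where $S(K_s^{(2)})$ is the suspension of the complete 2-graph on $s$ vertices and $\gamma$ denotes codegree density.
   Context: A 3-graph is a pair $G=(V,E)$ with $V$ a finite vertex set and $E$ a set of 3-element subsets of $V$ (the 3-edges). A 3-graph contains another 3-graph $F$ as a subgraph if it has a (not necessarily induced) subgraph isomorphic to $F$. A 2-graph is an ordinary graph; $K_s^{(2)}$ is the complete 2-graph on $s$ vertices. For a 2-graph $H$, its suspension $S(H)$ is the 3-graph with vertex set $V(H)\sqcup\{x_\star\}$ and 3-edges $\{x_\star vv': vv'\in E(H)\}$. For a family $\mathcal{F}$ of non-empty 3-graphs (i.e. each having at least one 3-edge), the codegree threshold $\mathrm{coex}(n,\mathcal{F})$ is the largest integer $d$ such that there exists an $n$-vertex 3-graph in which every pair of distinct vertices is contained in at least $d$ 3-edges and which contains no member of $\mathcal{F}$ as a subgraph. The codegree density of $\mathcal{F}$ is $\gamma(\mathcal{F})=\lim_{n\to\infty}\frac{\mathrm{coex}(n,\mathcal{F})}{n-2}$; this limit is known to exist for every such $\mathcal{F}$ (Mubayi and Zhao). For a single 3-graph $F$, write $\gamma(F)=\gamma(\{F\})$. *)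

theory Defs
  imports Complex_Main
begin

type_synonym 'a hgraph = "'a set \<times> 'a set set"

abbreviation verts :: "'a hgraph \<Rightarrow> 'a set" where "verts G \<equiv> fst G"
abbreviation edges :: "'a hgraph \<Rightarrow> 'a set set" where "edges G \<equiv> snd G"

definition uniform_graph :: "nat \<Rightarrow> 'a hgraph \<Rightarrow> bool" where
  "uniform_graph k G \<longleftrightarrow>
     finite (verts G) \<and> (\<forall>e\<in>edges G. e \<subseteq> verts G \<and> card e = k)"

abbreviation "graph2 \<equiv> uniform_graph 2"
abbreviation "graph3 \<equiv> uniform_graph 3"

definition subgraph3 :: "'a hgraph \<Rightarrow> 'a hgraph \<Rightarrow> bool" where
  "subgraph3 H G \<longleftrightarrow> graph3 H \<and> verts H \<subseteq> verts G \<and> edges H \<subseteq> edges G"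

definition hg_iso :: "'a hgraph \<Rightarrow> 'b hgraph \<Rightarrow> bool" where
  "hg_iso F H \<longleftrightarrow>
     (\<exists>f. bij_betw f (verts F) (verts H) \<and> edges H = (\<lambda>e. f ` e) ` edges F)"

definition contains3 :: "'b hgraph \<Rightarrow> 'a hgraph \<Rightarrow> bool" where
  "contains3 G F \<longleftrightarrow> (\<exists>H. subgraph3 H G \<and> hg_iso F H)"

definition codegree :: "'a hgraph \<Rightarrow> 'a \<Rightarrow> 'a \<Rightarrow> nat" where
  "codegree G u v = card {e \<in> edges G. u \<in> e \<and> v \<in> e}"

text \<open>
  Host graphs have their vertices in \<open>nat\<close>; every finite 3-graph is isomorphic to such
  a graph. If every member of \<open>\<F>\<close> has an edge, then \<open>d = 0\<close> is always attained (by the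
  edgeless graph), so restricting \<open>d\<close> to \<open>nat\<close> loses nothing. For \<open>n < 2\<close> there are no
  pairs, hence no largest \<open>d\<close>, and the value is unspecified.
\<close>
definition coex :: "nat \<Rightarrow> 'a hgraph set \<Rightarrow> nat" where
  "coex n \<F> = (GREATEST d. \<exists>G :: nat hgraph.
      graph3 G \<and> card (verts G) = n \<and>
      (\<forall>u\<in>verts G. \<forall>v\<in>verts G. u \<noteq> v \<longrightarrow> d \<le> codegree G u v) \<and>
      (\<forall>F\<in>\<F>. \<not> contains3 G F))"

definition codegree_density_family :: "'a hgraph set \<Rightarrow> real" where
  "codegree_density_family \<F> = lim (\<lambda>n. real (coex n \<F>) / (real n - 2))"

definition codegree_density :: "'a hgraph \<Rightarrow> real" where
  "codegree_density F = codegree_density_family {F}"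

definition complete_graph2 :: "nat \<Rightarrow> nat hgraph" where
  "complete_graph2 s = ({..<s}, {e. e \<subseteq> {..<s} \<and> card e = 2})"

text \<open>The new vertex of the suspension is \<open>None\<close>.\<close>
definition suspension :: "'a hgraph \<Rightarrow> 'a option hgraph" where
  "suspension H = (insert None (Some ` verts H), (\<lambda>e. insert None (Some ` e)) ` edges H)"

lemma graph2_complete_graph2: "graph2 (complete_graph2 s)"
  by (auto simp: uniform_graph_def complete_graph2_def)

lemma graph3_suspension:
  assumes "graph2 H"
  shows "graph3 (suspension H)"
proof -
  have "card (insert None (Some ` e)) = 3" if "e \<in> edges H" for e
  proof -
    have "card e = 2" using assms that by (auto simp: uniform_graph_def)
    moreover from this have "finite e" by (metis card.infinite zero_neq_numeral)
    ultimately show ?thesis by (simp add: card_image)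
  qed
  then show ?thesis using assms by (auto simp: uniform_graph_def suspension_def)
qed

lemma suspension_complete_nonempty:
  assumes "s \<ge> 2"
  shows "edges (suspension (complete_graph2 s)) \<noteq> {}"
proof -
  have "{0, 1} \<in> edges (complete_graph2 s)"
    using assms by (auto simp: complete_graph2_def)
  then show ?thesis by (auto simp: suspension_def)
qed

end

theory Submission imports Defs "HOL-Library.FuncSet" begin

text \<open>
  Colour the pairs of vertices of an \<open>n\<close>-set independently and uniformly with \<open>q = s - 1\<close> colours
  and take the rainbow triangles as 3-edges. The link of a vertex \<open>x\<close> is then properly coloured by
  \<open>y \<mapsto> c {x, y}\<close>, so it contains no \<open>K\<^sub>s\<close>. Given the colour of \<open>{x, y}\<close>, a third vertex completes
  a rainbow triangle with probability \<open>(1 - 1/q)(1 - 2/q)\<close>, and by a Chernoff bound all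
  codegrees are close to this proportion simultaneously.

  The density is defined through \<open>lim\<close>, so the bound also needs the limit to exist. For this, map
  an \<open>m\<close>-set at random into an extremal 3-graph on \<open>n\<close> vertices, with \<open>n\<close> much larger than \<open>m\<close>: the
  map is likely to be injective, and the same Chernoff bound shows that it likely preserves all
  relative codegrees up to \<open>\<epsilon>\<close>.
\<close>

section \<open>Concentration for functions on a finite set\<close>


text \<open>Since \<open>(1 + x) * (1 - x + x\<^sup>2) = 1 + x ^ 3\<close>, the bound
  \<open>1 + x \<le> exp x\<close> suffices. The estimate controls the exponential moment of a
  single coordinate in the Chernoff argument.\<close>

lemma exp_minus_le_quadratic:
  fixes x :: real
  assumes "0 \<le> x"
  shows "exp (- x) \<le> 1 - x + x\<^sup>2"
proof -
  have "1 \<le> (1 + x) * (1 - x + x\<^sup>2)"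
    using assms by (simp add: algebra_simps power2_eq_square)
  also have "\<dots> \<le> exp x * (1 - x + x\<^sup>2)"
  proof (rule mult_right_mono)
    have "0 \<le> (x - 1 / 2)\<^sup>2 + 3 / 4" by simp
    then show "0 \<le> 1 - x + x\<^sup>2" by (simp add: power2_eq_square algebra_simps)
  qed simp
  finally show ?thesis by (simp add: exp_minus field_simps)
qed

text \<open>Chernoff's method, with counting in place of probability: a weight
  \<open>exp (- l)\<close> per hit makes the weight of a function a product over its coordinates, so
  the total weight of all functions factorises. Markov's inequality then bounds the number of
  functions with few hits.\<close>

lemma card_PiE_lower_tail:
  fixes S :: "'a set" and B :: "'i \<Rightarrow> 'a set" and \<epsilon> :: real
  assumes "finite D" "finite S" "S \<noteq> {}" "0 \<le> \<epsilon>"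
  defines "\<mu> \<equiv> (\<Sum>i\<in>D. real (card (S \<inter> B i)) / real (card S))"
  shows "real (card {h \<in> D \<rightarrow>\<^sub>E S. real (card {i\<in>D. h i \<in> B i}) < \<mu> - \<epsilon> * real (card D)})
           \<le> exp (- \<epsilon>\<^sup>2 * real (card D) / 4) * real (card (D \<rightarrow>\<^sub>E S))"
proof -
  define n where "n = real (card S)"
  \<comment> \<open>The final exponent is at most
    \<open>(l\<^sup>2 - l * \<epsilon>) * card D\<close>, which is least for this
    \<open>l\<close>.\<close>
  define l where "l = \<epsilon> / 2"
  define w where "w i a = (if a \<in> B i then exp (- l) else 1)" for i a
  define p where "p i = real (card (S \<inter> B i)) / n" for i
  let ?X = "{h \<in> D \<rightarrow>\<^sub>E S. real (card {i\<in>D. h i \<in> B i}) < \<mu> - \<epsilon> * real (card D)}"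
  have n: "n > 0" using assms by (simp add: n_def card_gt_0_iff)
  have l: "0 \<le> l" using assms by (simp add: l_def)
  have fin: "finite (D \<rightarrow>\<^sub>E S)" using assms by (simp add: finite_PiE)
  have mu: "\<mu> = (\<Sum>i\<in>D. p i)" by (simp add: \<mu>_def p_def n_def)
  have p1: "p i \<le> 1" for i
    using n assms(2) by (simp add: p_def n_def card_mono divide_le_eq)
  have mu_le: "\<mu> \<le> real (card D)"
    using sum_mono[of D p "\<lambda>_. 1"] p1 by (simp add: mu)
  have wprod: "(\<Prod>i\<in>D. w i (h i)) = exp (- l * real (card {i\<in>D. h i \<in> B i}))" for h
    using assms(1) by (simp add: w_def prod.If_cases Int_def exp_of_nat_mult[symmetric] mult.commute)
  have wsum: "(\<Sum>a\<in>S. w i a) \<le> n * exp (- (l - l\<^sup>2) * p i)" for i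
  proof -
    have "(\<Sum>a\<in>S. w i a) = real (card (S \<inter> B i)) * exp (- l) + real (card (S - B i))"
      using assms(2) by (simp add: w_def sum.If_cases Diff_eq)
    also have "real (card (S - B i)) = n - real (card (S \<inter> B i))"
      using card_Diff_subset_Int[of S "B i"] assms(2)
      by (simp add: n_def of_nat_diff card_mono)
    also have "real (card (S \<inter> B i)) * exp (- l) + (n - real (card (S \<inter> B i))) = n * (1 - p i * (1 - exp (- l)))"
      using n by (simp add: p_def field_simps)
    also have "\<dots> \<le> n * (1 + - (l - l\<^sup>2) * p i)"
    proof -
      have "p i * (l - l\<^sup>2) \<le> p i * (1 - exp (- l))"
        using exp_minus_le_quadratic[OF l] n by (intro mult_left_mono) (auto simp: p_def)
      then show ?thesis using n by (intro mult_left_mono) (auto simp: algebra_simps)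
    qed
    also have "\<dots> \<le> n * exp (- (l - l\<^sup>2) * p i)"
      using n by (intro mult_left_mono exp_ge_add_one_self) auto
    finally show ?thesis .
  qed
  \<comment> \<open>Markov's inequality: a function in \<open>?X\<close> has so few hits that its
    weight is at least \<open>exp (- l * (\<mu> - \<epsilon> * card D))\<close>.\<close>
  have "real (card ?X) * exp (- l * (\<mu> - \<epsilon> * real (card D)))
          = (\<Sum>h\<in>?X. exp (- l * (\<mu> - \<epsilon> * real (card D))))" by simp
  also have "\<dots> \<le> (\<Sum>h\<in>?X. \<Prod>i\<in>D. w i (h i))"
    using l by (intro sum_mono) (auto simp: wprod intro!: mult_left_mono)
  also have "\<dots> \<le> (\<Sum>h\<in>D \<rightarrow>\<^sub>E S. \<Prod>i\<in>D. w i (h i))"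
    using fin by (intro sum_mono2 prod_nonneg) (auto simp: w_def)
  \<comment> \<open>Independence of the coordinates: the sum over all functions of a product is the
    product of the sums.\<close>
  also have "\<dots> = (\<Prod>i\<in>D. \<Sum>a\<in>S. w i a)"
    using assms by (subst prod_sum_PiE) auto
  also have "\<dots> \<le> (\<Prod>i\<in>D. n * exp (- (l - l\<^sup>2) * p i))"
    using wsum by (intro prod_mono) (auto simp: w_def intro!: sum_nonneg)
  also have "\<dots> = n ^ card D * exp (- (l - l\<^sup>2) * \<mu>)"
    using assms(1) by (simp add: prod.distrib mu exp_sum[symmetric] sum_distrib_left)
  finally have "real (card ?X) * exp (- l * (\<mu> - \<epsilon> * real (card D)))
      \<le> n ^ card D * exp (- (l - l\<^sup>2) * \<mu>)" .
  then have "real (card ?X) \<le> n ^ card D * exp (- (l - l\<^sup>2) * \<mu>) / exp (- l * (\<mu> - \<epsilon> * real (card D)))"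
    by (simp add: pos_le_divide_eq)
  also have "\<dots> = n ^ card D * exp (l\<^sup>2 * \<mu> - l * \<epsilon> * real (card D))"
  proof -
    have "- (l - l\<^sup>2) * \<mu> = (l\<^sup>2 * \<mu> - l * \<epsilon> * real (card D)) + - l * (\<mu> - \<epsilon> * real (card D))"
      by (simp add: algebra_simps)
    then show ?thesis by (simp only: exp_add) simp
  qed
  also have "\<dots> \<le> n ^ card D * exp (- \<epsilon>\<^sup>2 * real (card D) / 4)"
  proof -
    have "l\<^sup>2 * \<mu> \<le> l\<^sup>2 * real (card D)" using mu_le by (intro mult_left_mono) auto
    then show ?thesis using n by (auto simp: l_def power2_eq_square)
  qed
  also have "n ^ card D = real (card (D \<rightarrow>\<^sub>E S))"
    using assms(1) by (simp add: card_PiE n_def)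
  finally show ?thesis by (simp add: mult.commute)
qed

text \<open>The law of total probability: a function on \<open>K\<close> is determined by its
  restrictions to \<open>K - D\<close> and \<open>D\<close>, so a bound valid for each fixed
  restriction \<open>g\<close> can be summed over all \<open>g\<close>.\<close>

lemma card_PiE_fibrewise_le:
  fixes \<delta> :: real
  assumes "finite K" "finite S" "D \<subseteq> K"
    and "\<And>g. g \<in> (K - D) \<rightarrow>\<^sub>E S \<Longrightarrow> real (card {h \<in> D \<rightarrow>\<^sub>E S. Q g h}) \<le> \<delta> * real (card (D \<rightarrow>\<^sub>E S))"
  shows "real (card {c \<in> K \<rightarrow>\<^sub>E S. Q (restrict c (K - D)) (restrict c D)})
           \<le> \<delta> * real (card (K \<rightarrow>\<^sub>E S))"
proof -
  let ?X = "{c \<in> K \<rightarrow>\<^sub>E S. Q (restrict c (K - D)) (restrict c D)}"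
  let ?Y = "SIGMA g : (K - D) \<rightarrow>\<^sub>E S. {h \<in> D \<rightarrow>\<^sub>E S. Q g h}"
  let ?r = "\<lambda>c. (restrict c (K - D), restrict c D)"
  have fD: "finite D" using assms finite_subset by blast
  have f1: "finite (D \<rightarrow>\<^sub>E S)" and f2: "finite ((K - D) \<rightarrow>\<^sub>E S)"
    using assms fD by (simp_all add: finite_PiE)
  have "inj_on ?r ?X"
  proof (rule inj_onI)
    fix c c' assume c: "c \<in> ?X" "c' \<in> ?X" and eq: "?r c = ?r c'"
    have "c i = c' i" if "i \<in> K" for i
      using eq that by (cases "i \<in> D") (auto dest: fun_cong[where x = i])
    then show "c = c'" using c by (auto intro: PiE_ext)
  qed
  moreover have "restrict c (K - D) \<in> (K - D) \<rightarrow>\<^sub>E S \<and> restrict c D \<in> D \<rightarrow>\<^sub>E S" if "c \<in> K \<rightarrow>\<^sub>E S" for c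
    using that assms(3) unfolding restrict_PiE_iff by (auto dest: PiE_mem)
  then have "?r ` ?X \<subseteq> ?Y"
    by (intro image_subsetI) (simp only: mem_Sigma_iff mem_Collect_eq simp_thms)
  moreover have "finite ?Y" using f1 f2 by auto
  ultimately have "card ?X \<le> card ?Y" by (rule card_inj_on_le)
  also have "card ?Y = (\<Sum>g\<in>(K - D) \<rightarrow>\<^sub>E S. card {h \<in> D \<rightarrow>\<^sub>E S. Q g h})"
    using f1 f2 by (subst card_SigmaI) auto
  finally have "real (card ?X) \<le> real (\<Sum>g\<in>(K - D) \<rightarrow>\<^sub>E S. card {h \<in> D \<rightarrow>\<^sub>E S. Q g h})"
    by (simp only: of_nat_le_iff)
  also have "\<dots> = (\<Sum>g\<in>(K - D) \<rightarrow>\<^sub>E S. real (card {h \<in> D \<rightarrow>\<^sub>E S. Q g h}))"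
    by (rule of_nat_sum)
  also have "\<dots> \<le> (\<Sum>g\<in>(K - D) \<rightarrow>\<^sub>E S. \<delta> * real (card (D \<rightarrow>\<^sub>E S)))"
    using assms(4) by (rule sum_mono)
  also have "\<dots> = \<delta> * real (card S ^ card (K - D) * card S ^ card D)"
    using assms(1) fD by (simp add: card_PiE)
  also have "card S ^ card (K - D) * card S ^ card D = card (K \<rightarrow>\<^sub>E S)"
    using assms fD by (simp add: card_PiE power_add[symmetric] card_Diff_subset card_mono)
  finally show ?thesis .
qed

text \<open>The target sets \<open>B c i\<close> may depend on the coordinates of \<open>c\<close> outside \<open>D\<close>: the tail bound is
  applied after conditioning on these.\<close>
lemma card_PiE_conditional_lower_tail:
  fixes S :: "'a set" and B :: "('i \<Rightarrow> 'a) \<Rightarrow> 'i \<Rightarrow> 'a set" and \<epsilon> :: real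
  assumes "finite K" "finite S" "S \<noteq> {}" "D \<subseteq> K" "0 \<le> \<epsilon>"
    and indep: "\<And>c c' i. i \<in> D \<Longrightarrow> (\<And>j. j \<in> K - D \<Longrightarrow> c j = c' j) \<Longrightarrow> B c i = B c' i"
  shows "real (card {c \<in> K \<rightarrow>\<^sub>E S. real (card {i\<in>D. c i \<in> B c i})
               < (\<Sum>i\<in>D. real (card (S \<inter> B c i)) / real (card S)) - \<epsilon> * real (card D)})
           \<le> exp (- \<epsilon>\<^sup>2 * real (card D) / 4) * real (card (K \<rightarrow>\<^sub>E S))"
proof -
  define Q where "Q g h \<longleftrightarrow> real (card {i\<in>D. h i \<in> B g i})
               < (\<Sum>i\<in>D. real (card (S \<inter> B g i)) / real (card S)) - \<epsilon> * real (card D)"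
    for g h :: "'i \<Rightarrow> 'a"
  have "finite D" using assms finite_subset by blast
  then have "real (card {c \<in> K \<rightarrow>\<^sub>E S. Q (restrict c (K - D)) (restrict c D)})
           \<le> exp (- \<epsilon>\<^sup>2 * real (card D) / 4) * real (card (K \<rightarrow>\<^sub>E S))"
    unfolding Q_def using assms by (intro card_PiE_fibrewise_le card_PiE_lower_tail) auto
  \<comment> \<open>\<open>B\<close> reads its first argument only on \<open>K - D\<close>, so both
    restrictions can be replaced by \<open>c\<close> itself.\<close>
  moreover have "B (restrict c (K - D)) i = B c i" if "i \<in> D" for c i
    using that by (rule indep) auto
  then have "Q (restrict c (K - D)) (restrict c D) \<longleftrightarrow> Q c c" for c
    unfolding Q_def by (simp cong: conj_cong)
  ultimately show ?thesis by (simp add: Q_def)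
qed


text \<open>The union bound: the bad sets together have fewer than \<open>card \<Omega>\<close>
  elements and cannot cover \<open>\<Omega>\<close>.\<close>

lemma ex_avoiding_all:
  fixes \<delta> :: real
  assumes "finite \<Omega>" "\<Omega> \<noteq> {}" "finite P"
    and "\<And>p. p \<in> P \<Longrightarrow> real (card {c \<in> \<Omega>. bad p c}) \<le> \<delta> * real (card \<Omega>)"
    and "real (card P) * \<delta> < 1"
  shows "\<exists>c\<in>\<Omega>. \<forall>p\<in>P. \<not> bad p c"
proof (rule ccontr)
  assume "\<not> ?thesis"
  then have "\<Omega> \<subseteq> (\<Union>p\<in>P. {c \<in> \<Omega>. bad p c})" by blast
  then have "card \<Omega> \<le> card (\<Union>p\<in>P. {c \<in> \<Omega>. bad p c})"
    using assms by (intro card_mono) auto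
  also have "\<dots> \<le> (\<Sum>p\<in>P. card {c \<in> \<Omega>. bad p c})"
    using assms(3) by (rule card_UN_le)
  finally have "real (card \<Omega>) \<le> real (\<Sum>p\<in>P. card {c \<in> \<Omega>. bad p c})"
    by (simp only: of_nat_le_iff)
  also have "\<dots> = (\<Sum>p\<in>P. real (card {c \<in> \<Omega>. bad p c}))"
    by (rule of_nat_sum)
  also have "\<dots> \<le> (\<Sum>p\<in>P. \<delta> * real (card \<Omega>))"
    using assms(4) by (rule sum_mono)
  also have "\<dots> = (real (card P) * \<delta>) * real (card \<Omega>)" by simp
  also have "\<dots> < 1 * real (card \<Omega>)"
    using assms by (intro mult_strict_right_mono) (auto simp: card_gt_0_iff)
  finally show False by simp
qed

section \<open>Existence of the codegree density\<close>

text \<open>\<open>Inf U\<close> in the proof is the limit superior of \<open>a\<close>. By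
  \<open>step\<close>, \<open>a m + \<epsilon>\<close> is an eventual upper bound of the sequence
  for every large \<open>m\<close>, so the limit inferior is no smaller than the limit
  superior.\<close>

lemma convergent_if_eventually_almost_max:
  fixes a :: "nat \<Rightarrow> real"
  assumes bdd: "\<And>n. b \<le> a n" "\<And>n. a n \<le> B"
    and step: "\<And>\<epsilon>. 0 < \<epsilon> \<Longrightarrow> \<exists>M. \<forall>m\<ge>M. \<exists>N. \<forall>n\<ge>N. a n - \<epsilon> \<le> a m"
  shows "convergent a"
proof -
  define U where "U = {x. \<exists>N. \<forall>n\<ge>N. a n \<le> x}"
  have bU: "b \<le> x" if "x \<in> U" for x
    using that bdd(1) order_trans by (fastforce simp: U_def)
  have "B \<in> U" using bdd(2) by (simp add: U_def)
  moreover have "bdd_below U" using bU by (rule bdd_belowI)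
  ultimately have U: "U \<noteq> {}" "bdd_below U" by auto
  have "a \<longlonglongrightarrow> Inf U"
  proof (rule LIMSEQ_I)
    fix r :: real assume r: "0 < r"
    obtain x where x: "x \<in> U" "x < Inf U + r"
      using U r cInf_lessD[of U "Inf U + r"] by auto
    then obtain N where N: "\<And>n. n \<ge> N \<Longrightarrow> a n \<le> x" by (auto simp: U_def)
    from step[of "r / 2"] r obtain M where M: "\<And>m. m \<ge> M \<Longrightarrow> \<exists>N. \<forall>n\<ge>N. a n - r / 2 \<le> a m"
      by auto
    have "norm (a m - Inf U) < r" if m: "m \<ge> max M N" for m
    proof -
      have "a m + r / 2 \<in> U" using M[of m] m by (force simp: U_def algebra_simps)
      then have "Inf U \<le> a m + r / 2" using U by (intro cInf_lower)
      moreover have "a m < Inf U + r" using N[of m] m x by simp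
      ultimately show ?thesis using r by (simp add: abs_less_iff)
    qed
    then show "\<exists>no. \<forall>n\<ge>no. norm (a n - Inf U) < r" by blast
  qed
  then show ?thesis by (rule convergentI)
qed

text \<open>The union bounds range over at most \<open>n\<^sup>2\<close> pairs of vertices, and each
  pair has \<open>n - 2\<close> candidates for a third vertex; this limit makes the exponential
  tails win.\<close>

lemma square_times_exp_tendsto_0:
  fixes c :: real
  assumes "0 < c"
  shows "(\<lambda>n. (real n)\<^sup>2 * exp (- c * (real n - 2))) \<longlonglongrightarrow> 0"
proof -
  have "filterlim (\<lambda>n. c * real n) at_top sequentially"
    using assms by (intro filterlim_tendsto_pos_mult_at_top[OF tendsto_const] filterlim_real_sequentially)
  from filterlim_compose[OF tendsto_power_div_exp_0[of 2] this]
  have "(\<lambda>n. exp (2 * c) / c\<^sup>2 * ((c * real n)\<^sup>2 / exp (c * real n))) \<longlonglongrightarrow> exp (2 * c) / c\<^sup>2 * 0"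
    by (rule tendsto_mult_left)
  moreover have "exp (2 * c) / c\<^sup>2 * ((c * real n)\<^sup>2 / exp (c * real n))
      = (real n)\<^sup>2 * exp (- c * (real n - 2))" for n
    using assms by (simp add: power_mult_distrib exp_diff[symmetric] algebra_simps)
       (simp add: exp_diff mult_ac)
  ultimately show ?thesis by simp
qed

section \<open>Codegrees and the extremal function \<open>coex\<close>\<close>

lemma card_triple_eq_3_iff: "card {u, v, w} = 3 \<longleftrightarrow> u \<noteq> v \<and> u \<noteq> w \<and> v \<noteq> w"
  by (auto simp: card_insert_if)

text \<open>Edges through \<open>u\<close> and \<open>v\<close> correspond to their third vertices.
  Counting vertices instead of edges gives codegrees the form to which the tail bounds
  apply.\<close>

lemma codegree_conv_card_third_vertex:
  assumes "graph3 G" "u \<noteq> v"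
  shows "codegree G u v = card {w. {u, v, w} \<in> edges G}"
proof -
  have d: "u \<noteq> w \<and> v \<noteq> w" if "{u, v, w} \<in> edges G" for w
    using assms that card_triple_eq_3_iff[of u v w] by (auto simp: uniform_graph_def)
  have "{e \<in> edges G. u \<in> e \<and> v \<in> e} = (\<lambda>w. {u, v, w}) ` {w. {u, v, w} \<in> edges G}"
  proof (intro equalityI subsetI)
    fix e assume e: "e \<in> {e \<in> edges G. u \<in> e \<and> v \<in> e}"
    then have "card e = 3" using assms by (auto simp: uniform_graph_def)
    then have "card (e - {u, v}) = 1" using e assms(2) by (subst card_Diff_subset) auto
    then obtain w where "e - {u, v} = {w}" by (rule card_1_singletonE)
    then have "e = {u, v, w}" using e by auto
    then show "e \<in> (\<lambda>w. {u, v, w}) ` {w. {u, v, w} \<in> edges G}" using e by auto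
  qed auto
  moreover have "inj_on (\<lambda>w. {u, v, w}) {w. {u, v, w} \<in> edges G}"
    using d by (intro inj_onI) (auto simp: set_eq_iff, metis)
  ultimately show ?thesis by (simp add: codegree_def card_image)
qed

lemma codegree_le:
  assumes "graph3 G" "u \<in> verts G" "v \<in> verts G" "u \<noteq> v"
  shows "codegree G u v \<le> card (verts G) - 2"
proof -
  have "{w. {u, v, w} \<in> edges G} \<subseteq> verts G - {u, v}"
    using assms(1) card_triple_eq_3_iff[of u v] by (auto simp: uniform_graph_def)
  then have "codegree G u v \<le> card (verts G - {u, v})"
    using assms codegree_conv_card_third_vertex[of G u v]
    by (metis (no_types, lifting) card_mono finite_Diff uniform_graph_def)
  also have "\<dots> = card (verts G) - 2"
    using assms by (subst card_Diff_subset) auto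
  finally show ?thesis .
qed

text \<open>The second hypothesis is the predicate under \<open>GREATEST\<close> in
  \<open>coex\<close>; the bound guarantees that a greatest \<open>d\<close> exists. A pair of
  distinct vertices, available for \<open>n \<ge> 2\<close>, supplies it.\<close>

lemma min_codegree_le:
  assumes "n \<ge> 2"
    and "\<exists>G :: nat hgraph. graph3 G \<and> card (verts G) = n \<and>
      (\<forall>u\<in>verts G. \<forall>v\<in>verts G. u \<noteq> v \<longrightarrow> d \<le> codegree G u v) \<and> (\<forall>F\<in>\<F>. \<not> contains3 G F)"
  shows "d \<le> n - 2"
proof -
  from assms(2) obtain G :: "nat hgraph" where G: "graph3 G" "card (verts G) = n"
    "\<forall>u\<in>verts G. \<forall>v\<in>verts G. u \<noteq> v \<longrightarrow> d \<le> codegree G u v" by blast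
  have "\<exists>u\<in>verts G. \<exists>v\<in>verts G. u \<noteq> v"
    using assms(1) G card_le_Suc0_iff_eq[of "verts G"] by (force simp: uniform_graph_def)
  then obtain u v where "u \<in> verts G" "v \<in> verts G" "u \<noteq> v" by blast
  then show ?thesis using G codegree_le[of G u v] by fastforce
qed

lemma coex_greatest:
  fixes G :: "nat hgraph"
  assumes "n \<ge> 2" "graph3 G" "card (verts G) = n"
    and "\<And>u v. u \<in> verts G \<Longrightarrow> v \<in> verts G \<Longrightarrow> u \<noteq> v \<Longrightarrow> d \<le> codegree G u v"
    and "\<And>F. F \<in> \<F> \<Longrightarrow> \<not> contains3 G F"
  shows "d \<le> coex n \<F>"
  unfolding coex_def
proof (rule Greatest_le_nat[where b = "n - 2"])
  show "\<exists>G :: nat hgraph. graph3 G \<and> card (verts G) = n \<and>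
      (\<forall>u\<in>verts G. \<forall>v\<in>verts G. u \<noteq> v \<longrightarrow> d \<le> codegree G u v) \<and> (\<forall>F\<in>\<F>. \<not> contains3 G F)"
    using assms by (intro exI[of _ G]) simp
qed (rule min_codegree_le[OF assms(1)])

lemma not_contains3_edgeless:
  assumes "edges F \<noteq> {}" "edges G = {}"
  shows "\<not> contains3 G F"
  using assms by (auto simp: contains3_def subgraph3_def hg_iso_def)

text \<open>The edgeless 3-graph satisfies the predicate with \<open>d = 0\<close>, and admissible
  \<open>d\<close> are bounded, so \<open>GREATEST\<close> is attained.\<close>

lemma coex_attained:
  assumes "n \<ge> 2" "\<And>F. F \<in> \<F> \<Longrightarrow> edges F \<noteq> {}"
  obtains G :: "nat hgraph" where "graph3 G" "card (verts G) = n"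
    "\<And>u v. u \<in> verts G \<Longrightarrow> v \<in> verts G \<Longrightarrow> u \<noteq> v \<Longrightarrow> coex n \<F> \<le> codegree G u v"
    "\<And>F. F \<in> \<F> \<Longrightarrow> \<not> contains3 G F"
proof -
  let ?P = "\<lambda>d. \<exists>G :: nat hgraph. graph3 G \<and> card (verts G) = n \<and>
      (\<forall>u\<in>verts G. \<forall>v\<in>verts G. u \<noteq> v \<longrightarrow> d \<le> codegree G u v) \<and> (\<forall>F\<in>\<F>. \<not> contains3 G F)"
  have "?P 0"
    using assms(2)
    by (intro exI[of _ "({..<n}, {})"]) (auto simp: uniform_graph_def not_contains3_edgeless)
  then have "?P (coex n \<F>)"
    unfolding coex_def by (rule GreatestI_nat[where b = "n - 2"]) (rule min_codegree_le[OF assms(1)])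
  then show ?thesis using that by blast
qed

lemma coex_le:
  assumes "n \<ge> 2" "\<And>F. F \<in> \<F> \<Longrightarrow> edges F \<noteq> {}"
  shows "coex n \<F> \<le> n - 2"
proof -
  obtain G :: "nat hgraph" where "graph3 G" "card (verts G) = n"
    "\<And>u v. u \<in> verts G \<Longrightarrow> v \<in> verts G \<Longrightarrow> u \<noteq> v \<Longrightarrow> coex n \<F> \<le> codegree G u v"
    "\<And>F. F \<in> \<F> \<Longrightarrow> \<not> contains3 G F"
    using coex_attained[of n \<F>] assms by blast
  then show ?thesis using min_codegree_le[of n "coex n \<F>" \<F>] assms(1) by blast
qed

section \<open>Random sampling from a 3-graph\<close>

definition pullback3 :: "('b \<Rightarrow> 'a) \<Rightarrow> 'b set \<Rightarrow> 'a hgraph \<Rightarrow> 'b hgraph" where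
  "pullback3 f W G = (W, {e. e \<subseteq> W \<and> card e = 3 \<and> f ` e \<in> edges G})"

lemma graph3_pullback3: "finite W \<Longrightarrow> graph3 (pullback3 f W G)"
  by (auto simp: uniform_graph_def pullback3_def)

text \<open>The image under \<open>f\<close> of a copy of \<open>F\<close> is again a copy of
  \<open>F\<close>, because \<open>f\<close> is injective on the vertices of the copy. Hence samples
  inherit the absence of \<open>F\<close>.\<close>

lemma contains3_pullback3D:
  assumes "contains3 (pullback3 f W G) F" "inj_on f W" "f ` W \<subseteq> verts G" "graph3 G"
  shows "contains3 G F"
proof -
  from assms(1) obtain H g where H: "graph3 H" "verts H \<subseteq> W"
      "edges H \<subseteq> {e. e \<subseteq> W \<and> card e = 3 \<and> f ` e \<in> edges G}"
    and g: "bij_betw g (verts F) (verts H)" "edges H = (\<lambda>e. g ` e) ` edges F"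
    by (auto simp: contains3_def subgraph3_def hg_iso_def pullback3_def)
  define H' where "H' = (f ` verts H, (`) f ` edges H)"
  have "subgraph3 H' G"
    using H assms by (fastforce simp: subgraph3_def H'_def uniform_graph_def)
  moreover have "bij_betw (f \<circ> g) (verts F) (verts H')"
    using g(1) inj_on_subset[OF assms(2) H(2)]
    by (auto simp: H'_def intro!: bij_betw_trans inj_on_imp_bij_betw)
  moreover have "edges H' = (\<lambda>e. (f \<circ> g) ` e) ` edges F"
    by (simp add: H'_def g(2) image_comp comp_def image_image)
  ultimately show ?thesis unfolding contains3_def hg_iso_def by blast
qed


text \<open>For a uniformly random map a given pair collides with probability at most
  \<open>1 / n\<close>, and its sampled codegree is too small with exponentially small probability.
  \<open>small\<close> lets the union bound exclude both events for all pairs.\<close>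

lemma ex_injection_preserving_codegree:
  fixes \<epsilon> :: real
  assumes G: "graph3 G" "card (verts G) = n" "0 < n"
    and deg: "\<And>u v. u \<in> verts G \<Longrightarrow> v \<in> verts G \<Longrightarrow> u \<noteq> v \<Longrightarrow> d \<le> codegree G u v"
    and eps: "0 \<le> \<epsilon>" and m: "2 \<le> m"
    and small: "(real m)\<^sup>2 * (1 / real n + exp (- \<epsilon>\<^sup>2 * (real m - 2) / 4)) < 1"
  shows "\<exists>f. inj_on f {..<m} \<and> f ` {..<m} \<subseteq> verts G \<and>
    (\<forall>i<m. \<forall>j<m. i \<noteq> j \<longrightarrow> (real d / real n - \<epsilon>) * (real m - 2)
       \<le> real (card {k \<in> {..<m} - {i, j}. {f i, f j, f k} \<in> edges G}))"
proof -
  let ?\<Omega> = "{..<m} \<rightarrow>\<^sub>E verts G"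
  let ?I = "\<lambda>i j. {..<m} - {i, j}"
  let ?B = "\<lambda>i j f k. {w. {f i, f j, w} \<in> edges G}"
  let ?\<delta> = "1 / real n + exp (- \<epsilon>\<^sup>2 * (real m - 2) / 4)"
  define P where "P = {(i, j). i < m \<and> j < m \<and> i \<noteq> j}"
  define tail where "tail i j f \<longleftrightarrow> real (card {k \<in> ?I i j. f k \<in> ?B i j f k})
    < (\<Sum>k\<in>?I i j. real (card (verts G \<inter> ?B i j f k)) / real (card (verts G)))
      - \<epsilon> * real (card (?I i j))" for i j f
  define bad where "bad p f \<longleftrightarrow> (case p of (i, j) \<Rightarrow> f i = f j \<or> tail i j f)" for p f
  have V: "finite (verts G)" "verts G \<noteq> {}" using G by (auto simp: uniform_graph_def)
  have fin: "finite ?\<Omega>" using V by (simp add: finite_PiE)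
  have P_sub: "P \<subseteq> {..<m} \<times> {..<m}" by (auto simp: P_def)
  have "card P \<le> m * m" using card_mono[OF _ P_sub] by simp
  then have cardP: "real (card P) \<le> (real m)\<^sup>2"
    by (metis of_nat_le_iff of_nat_mult power2_eq_square)
  have cardI: "real (card (?I i j)) = real m - 2" if "(i, j) \<in> P" for i j
    using that m by (auto simp: P_def card_Diff_subset of_nat_diff)
  have collision: "real (card {f \<in> ?\<Omega>. f i = f j}) \<le> 1 / real n * real (card ?\<Omega>)"
    if "(i, j) \<in> P" for i j
  proof -
    \<comment> \<open>Condition on all values except \<open>f j\<close>: a collision leaves at most
      one of the \<open>n\<close> choices for \<open>f j\<close>.\<close>
    have "real (card {f \<in> ?\<Omega>. restrict f ({..<m} - {j}) i = restrict f {j} j})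
        \<le> 1 / real n * real (card ?\<Omega>)"
    proof (rule card_PiE_fibrewise_le)
      fix g :: "nat \<Rightarrow> 'a"
      have "{h \<in> {j} \<rightarrow>\<^sub>E verts G. g i = h j} \<subseteq> {restrict (\<lambda>_. g i) {j}}"
        by (auto simp: PiE_iff extensional_def fun_eq_iff)
      then have "card {h \<in> {j} \<rightarrow>\<^sub>E verts G. g i = h j} \<le> 1"
        using card_mono[of "{restrict (\<lambda>_. g i) {j}}"] by fastforce
      then show "real (card {h \<in> {j} \<rightarrow>\<^sub>E verts G. g i = h j})
          \<le> 1 / real n * real (card ({j} \<rightarrow>\<^sub>E verts G))"
        using G by (simp add: card_PiE)
    qed (use that V in \<open>auto simp: P_def\<close>)
    then show ?thesis using that by (simp add: P_def)
  qed
  \<comment> \<open>The target set depends only on \<open>f i\<close> and \<open>f j\<close>, and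
    the coordinates \<open>i\<close> and \<open>j\<close> lie outside \<open>?I i j\<close>, so the
    conditional tail bound applies.\<close>
  have tail: "real (card {f \<in> ?\<Omega>. tail i j f}) \<le> exp (- \<epsilon>\<^sup>2 * (real m - 2) / 4) * real (card ?\<Omega>)"
    if "(i, j) \<in> P" for i j
  proof -
    have "i < m" "j < m" using that by (auto simp: P_def)
    then have "real (card {f \<in> ?\<Omega>. tail i j f})
        \<le> exp (- \<epsilon>\<^sup>2 * real (card (?I i j)) / 4) * real (card ?\<Omega>)"
      unfolding tail_def using V eps
      by (intro card_PiE_conditional_lower_tail) auto
    then show ?thesis by (simp only: cardI[OF that])
  qed
  have "\<exists>f\<in>?\<Omega>. \<forall>p\<in>P. \<not> bad p f"
  proof (rule ex_avoiding_all)
    show "real (card {f \<in> ?\<Omega>. bad p f}) \<le> ?\<delta> * real (card ?\<Omega>)" if p: "p \<in> P" for p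
    proof -
      obtain i j where ij: "p = (i, j)" "(i, j) \<in> P" using p by (cases p) auto
      have "{f \<in> ?\<Omega>. bad p f} = {f \<in> ?\<Omega>. f i = f j} \<union> {f \<in> ?\<Omega>. tail i j f}"
        by (auto simp: bad_def ij)
      then have "card {f \<in> ?\<Omega>. bad p f} \<le> card {f \<in> ?\<Omega>. f i = f j} + card {f \<in> ?\<Omega>. tail i j f}"
        by (simp add: card_Un_le)
      then show ?thesis using collision[OF ij(2)] tail[OF ij(2)] by (simp add: distrib_right)
    qed
    show "real (card P) * ?\<delta> < 1"
      using mult_right_mono[OF cardP, of ?\<delta>] small by simp
    show "finite P" using P_sub finite_subset by blast
    show "?\<Omega> \<noteq> {}" using V by (simp add: PiE_eq_empty_iff)
  qed (rule fin)
  then obtain f where f: "f \<in> ?\<Omega>" and good: "\<And>i j. (i, j) \<in> P \<Longrightarrow> f i \<noteq> f j \<and> \<not> tail i j f"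
    by (auto simp: bad_def)
  have range: "f ` {..<m} \<subseteq> verts G" using f by auto
  have "inj_on f {..<m}" using good by (auto simp: inj_on_def P_def)
  moreover have "(real d / real n - \<epsilon>) * (real m - 2)
       \<le> real (card {k \<in> ?I i j. {f i, f j, f k} \<in> edges G})" if "i < m" "j < m" "i \<noteq> j" for i j
  proof -
    have ij: "(i, j) \<in> P" using that by (simp add: P_def)
    have ne: "f i \<noteq> f j" using good[OF ij] by simp
    have "verts G \<inter> {w. {f i, f j, w} \<in> edges G} = {w. {f i, f j, w} \<in> edges G}"
      using G by (auto simp: uniform_graph_def)
    then have "card (verts G \<inter> {w. {f i, f j, w} \<in> edges G}) = codegree G (f i) (f j)"
      using codegree_conv_card_third_vertex[OF G(1) ne] by simp
    moreover have "d \<le> codegree G (f i) (f j)" using ne range that by (intro deg) auto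
    \<comment> \<open>Each of the \<open>m - 2\<close> terms of the mean is the codegree of
      \<open>f i\<close> and \<open>f j\<close> divided by \<open>n\<close>, hence at least
      \<open>d / n\<close>.\<close>
    ultimately have "(real m - 2) * (real d / real n)
        \<le> (\<Sum>k\<in>?I i j. real (card (verts G \<inter> ?B i j f k)) / real (card (verts G)))"
      using m by (simp only: sum_constant cardI[OF ij] G) (intro mult_left_mono divide_right_mono, auto)
    then show ?thesis using good[OF ij]
      by (simp add: tail_def cardI[OF ij, simplified] algebra_simps del: card_Diff_insert)
  qed
  ultimately show ?thesis using range by blast
qed

text \<open>Pulling back an extremal 3-graph on \<open>n\<close> vertices along the sampled
  injection gives a competitor for \<open>coex m \<F>\<close>.\<close>

lemma coex_subsample:
  fixes \<epsilon> :: real and \<F> :: "'a hgraph set"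
  assumes F: "\<And>F. F \<in> \<F> \<Longrightarrow> edges F \<noteq> {}" and eps: "0 \<le> \<epsilon>" and "2 \<le> m" "2 \<le> n"
    and small: "(real m)\<^sup>2 * (1 / real n + exp (- \<epsilon>\<^sup>2 * (real m - 2) / 4)) < 1"
  shows "(real (coex n \<F>) / real n - \<epsilon>) * (real m - 2) \<le> real (coex m \<F>)"
proof -
  obtain G :: "nat hgraph" where G: "graph3 G" "card (verts G) = n"
    "\<And>u v. u \<in> verts G \<Longrightarrow> v \<in> verts G \<Longrightarrow> u \<noteq> v \<Longrightarrow> coex n \<F> \<le> codegree G u v"
    "\<And>F. F \<in> \<F> \<Longrightarrow> \<not> contains3 G F"
    using coex_attained[of n \<F>] assms by blast
  then obtain f where inj: "inj_on f {..<m}" and ran: "f ` {..<m} \<subseteq> verts G"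
    and deg: "\<And>i j. i < m \<Longrightarrow> j < m \<Longrightarrow> i \<noteq> j \<Longrightarrow> (real (coex n \<F>) / real n - \<epsilon>) * (real m - 2)
       \<le> real (card {k \<in> {..<m} - {i, j}. {f i, f j, f k} \<in> edges G})"
    using ex_injection_preserving_codegree[of G n "coex n \<F>" \<epsilon> m] assms by auto
  let ?x = "(real (coex n \<F>) / real n - \<epsilon>) * (real m - 2)"
  let ?H = "pullback3 f {..<m} G"
  \<comment> \<open>Codegrees are natural numbers, so the real lower bound \<open>?x\<close> may be
    rounded up; a negative \<open>?x\<close> becomes 0.\<close>
  have "nat \<lceil>?x\<rceil> \<le> coex m \<F>"
  proof (rule coex_greatest)
    show "graph3 ?H" by (simp add: graph3_pullback3)
    show "card (verts ?H) = m" by (simp add: pullback3_def)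
    show "\<not> contains3 ?H F" if "F \<in> \<F>" for F
      using G that contains3_pullback3D[OF _ inj ran] by blast
    fix i j assume "i \<in> verts ?H" "j \<in> verts ?H" and ne: "i \<noteq> j"
    then have ij: "i < m" "j < m" by (auto simp: pullback3_def)
    have "{k. {i, j, k} \<in> edges ?H} = {k \<in> {..<m} - {i, j}. {f i, f j, f k} \<in> edges G}"
      using ij ne by (auto simp: pullback3_def card_triple_eq_3_iff)
    then have "codegree ?H i j = card {k \<in> {..<m} - {i, j}. {f i, f j, f k} \<in> edges G}"
      using codegree_conv_card_third_vertex[OF \<open>graph3 ?H\<close> ne] by simp
    then show "nat \<lceil>?x\<rceil> \<le> codegree ?H i j"
      using deg[OF ij ne] by (simp add: nat_le_iff ceiling_le_iff)
  qed (rule assms)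
  then show ?thesis by (simp add: nat_le_iff ceiling_le_iff)
qed

lemma eventually_square_times_exp_less:
  fixes c r :: real
  assumes "0 < c" "0 < r"
  shows "\<exists>N. \<forall>n\<ge>N. (real n)\<^sup>2 * exp (- c * (real n - 2)) < r"
  using order_tendstoD(2)[OF square_times_exp_tendsto_0[OF assms(1)] assms(2)]
  by (simp add: eventually_sequentially)

text \<open>By sampling, the relative codegree for a large \<open>m\<close> is at least that for any
  much larger \<open>n\<close>, up to \<epsilon>. Thus the sequence converges and \<open>lim\<close>
  denotes its actual limit.\<close>

theorem codegree_density_family_LIMSEQ:
  fixes \<F> :: "'a hgraph set"
  assumes F: "\<And>F. F \<in> \<F> \<Longrightarrow> edges F \<noteq> {}"
  shows "(\<lambda>n. real (coex n \<F>) / (real n - 2)) \<longlonglongrightarrow> codegree_density_family \<F>"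
proof -
  let ?a = "\<lambda>n. real (coex n \<F>) / (real n - 2)"
  have a01: "0 \<le> ?a n \<and> ?a n \<le> 1" if "n \<ge> 2" for n
  proof -
    have "real (coex n \<F>) \<le> real n - 2"
      using coex_le[of n \<F>] F that by (metis of_nat_diff of_nat_le_iff of_nat_numeral)
    then show ?thesis using that by (auto simp: divide_le_eq_1)
  qed
  \<comment> \<open>The bounds 0 and 1 are available from index 2 on, where \<open>coex\<close> is
    well defined; at 2 itself the quotient is 0 by division by zero.\<close>
  have "convergent (\<lambda>n. ?a (n + 2))"
  proof (rule convergent_if_eventually_almost_max)
    show "0 \<le> ?a (n + 2)" "?a (n + 2) \<le> 1" for n using a01[of "n + 2"] by auto
    fix \<epsilon> :: real assume eps: "0 < \<epsilon>"
    \<comment> \<open>The failure budget is split evenly: \<open>M\<close> keeps the codegree tails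
      below \<open>1 / 2\<close>, and \<open>N\<close> below does the same for collisions.\<close>
    obtain M where M: "\<And>m. m \<ge> M \<Longrightarrow> (real m)\<^sup>2 * exp (- ((\<epsilon> / 2)\<^sup>2 / 4) * (real m - 2)) < 1 / 2"
      using eventually_square_times_exp_less[of "(\<epsilon> / 2)\<^sup>2 / 4" "1 / 2"] eps by auto
    have "\<exists>N. \<forall>n\<ge>N. ?a (n + 2) - \<epsilon> \<le> ?a (m + 2)" if m: "m \<ge> max M 1" for m
    proof -
      \<comment> \<open>The square term makes collisions unlikely; \<open>4 / \<epsilon>\<close>
        makes the change of denominator from \<open>n' - 2\<close> to \<open>n'\<close> cost at most
        \<open>\<epsilon> / 2\<close>.\<close>
      obtain N where N: "real N > 2 * (real (m + 2))\<^sup>2 + 4 / \<epsilon>"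
        using reals_Archimedean2 by blast
      have "?a (n + 2) - \<epsilon> \<le> ?a (m + 2)" if n: "n \<ge> N" for n
      proof -
        define n' m' where "n' = n + 2" and "m' = m + 2"
        have n': "real n' > 2 * (real m')\<^sup>2" "real n' > 4 / \<epsilon>" "n' > 2"
        proof -
          have pos: "4 / \<epsilon> > 0" "2 * (real m')\<^sup>2 \<ge> 0" using eps by auto
          have N': "real N > 2 * (real m')\<^sup>2 + 4 / \<epsilon>" using N by (simp only: m'_def)
          have "real n' > real N" using n by (simp add: n'_def)
          then show "real n' > 2 * (real m')\<^sup>2" "real n' > 4 / \<epsilon>" using pos N' by linarith+
          have "real N > 0" using pos N' by linarith
          then show "n' > 2" using n by (simp add: n'_def)
        qed
        have "(real m')\<^sup>2 * (1 / real n') < 1 / 2" using n' by (simp add: field_simps)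
        moreover have "(real m')\<^sup>2 * exp (- (\<epsilon> / 2)\<^sup>2 * (real m' - 2) / 4) < 1 / 2"
          using M[of m'] m by (simp add: m'_def)
        ultimately have "(real m')\<^sup>2 * (1 / real n' + exp (- (\<epsilon> / 2)\<^sup>2 * (real m' - 2) / 4)) < 1"
          unfolding distrib_left by linarith
        then have "(real (coex n' \<F>) / real n' - \<epsilon> / 2) * (real m' - 2) \<le> real (coex m' \<F>)"
          using F eps n' by (intro coex_subsample) (auto simp: m'_def)
        then have 1: "real (coex n' \<F>) / real n' - \<epsilon> / 2 \<le> ?a m'"
          using m by (simp add: m'_def pos_le_divide_eq)
        have "?a n' - real (coex n' \<F>) / real n' = ?a n' * (2 / real n')"
          using n' by (simp add: field_simps)
        also have "\<dots> \<le> 1 * (2 / real n')"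
          using a01[of n'] n' by (intro mult_right_mono) auto
        also have "\<dots> \<le> \<epsilon> / 2" using n' eps by (simp add: field_simps)
        finally have "?a n' - \<epsilon> \<le> ?a m'" using 1 by linarith
        then show ?thesis by (simp only: n'_def m'_def)
      qed
      then show ?thesis by blast
    qed
    then show "\<exists>M. \<forall>m\<ge>M. \<exists>N. \<forall>n\<ge>N. ?a (n + 2) - \<epsilon> \<le> ?a (m + 2)" by blast
  qed
  then have "convergent ?a" by (simp only: convergent_ignore_initial_segment[of ?a])
  then show ?thesis unfolding codegree_density_family_def by (simp add: convergent_LIMSEQ_iff)
qed


section \<open>Rainbow triangles in random colourings\<close>

text \<open>The exposed coordinates are reindexed along an injection \<phi>, so that hits can be
  counted by a third vertex \<open>z\<close> while the coordinates are the pairs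
  \<open>{x, z}\<close>.\<close>

lemma card_PiE_conditional_lower_tail_image:
  fixes S :: "'a set" and \<phi> :: "'j \<Rightarrow> 'i" and B :: "('i \<Rightarrow> 'a) \<Rightarrow> 'j \<Rightarrow> 'a set" and \<epsilon> :: real
  assumes "finite K" "finite S" "S \<noteq> {}" "\<phi> ` I \<subseteq> K" "inj_on \<phi> I" "0 \<le> \<epsilon>"
    and indep: "\<And>c c' i. i \<in> I \<Longrightarrow> (\<And>j. j \<in> K - \<phi> ` I \<Longrightarrow> c j = c' j) \<Longrightarrow> B c i = B c' i"
  shows "real (card {c \<in> K \<rightarrow>\<^sub>E S. real (card {i\<in>I. c (\<phi> i) \<in> B c i})
               < (\<Sum>i\<in>I. real (card (S \<inter> B c i)) / real (card S)) - \<epsilon> * real (card I)})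
           \<le> exp (- \<epsilon>\<^sup>2 * real (card I) / 4) * real (card (K \<rightarrow>\<^sub>E S))"
proof -
  define B' where "B' c e = B c (inv_into I \<phi> e)" for c e
  have B': "B' c (\<phi> i) = B c i" if "i \<in> I" for c i
    using that assms(5) by (simp add: B'_def)
  have "{e \<in> \<phi> ` I. c e \<in> B' c e} = \<phi> ` {i\<in>I. c (\<phi> i) \<in> B c i}" for c
    using B' by auto
  then have hits: "card {e \<in> \<phi> ` I. c e \<in> B' c e} = card {i\<in>I. c (\<phi> i) \<in> B c i}" for c
    using inj_on_subset[OF assms(5), of "{i\<in>I. c (\<phi> i) \<in> B c i}"] by (simp add: card_image)
  have mean: "(\<Sum>e\<in>\<phi> ` I. real (card (S \<inter> B' c e)) / real (card S))
      = (\<Sum>i\<in>I. real (card (S \<inter> B c i)) / real (card S))" for c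
    using assms(5) B' by (simp add: sum.reindex cong: sum.cong)
  have size: "card (\<phi> ` I) = card I" using assms(5) by (rule card_image)
  have indep': "B' c e = B' c' e" if "e \<in> \<phi> ` I" "\<And>j. j \<in> K - \<phi> ` I \<Longrightarrow> c j = c' j" for c c' e
  proof -
    obtain i where "i \<in> I" "e = \<phi> i" using \<open>e \<in> \<phi> ` I\<close> by blast
    then show ?thesis using B' indep[of i c c'] that by simp
  qed
  have "real (card {c \<in> K \<rightarrow>\<^sub>E S. real (card {e\<in>\<phi> ` I. c e \<in> B' c e})
               < (\<Sum>e\<in>\<phi> ` I. real (card (S \<inter> B' c e)) / real (card S)) - \<epsilon> * real (card (\<phi> ` I))})
           \<le> exp (- \<epsilon>\<^sup>2 * real (card (\<phi> ` I)) / 4) * real (card (K \<rightarrow>\<^sub>E S))"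
    using assms(1-4,6) indep' by (rule card_PiE_conditional_lower_tail)
  then show ?thesis by (simp only: hits mean size)
qed

text \<open>Each of the two exposures loses at most \<open>\<epsilon> * (n - 2)\<close> third
  vertices, which accounts for \<open>2 * \<epsilon>\<close>; the two tail events per pair account
  for the factor 2 in \<open>small\<close>.\<close>

lemma ex_colouring_many_rainbow_triangles:
  fixes \<epsilon> :: real and q n :: nat
  assumes q: "2 \<le> q" and n: "2 \<le> n" and eps: "0 \<le> \<epsilon>"
    and small: "(real n)\<^sup>2 * (2 * exp (- \<epsilon>\<^sup>2 * (real n - 2) / 4)) < 1"
  shows "\<exists>c :: nat set \<Rightarrow> nat. (\<forall>x<n. \<forall>y<n. c {x, y} < q) \<and>
    (\<forall>x<n. \<forall>y<n. x \<noteq> y \<longrightarrow> ((1 - 1 / real q) * (1 - 2 / real q) - 2 * \<epsilon>) * (real n - 2)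
       \<le> real (card {z \<in> {..<n} - {x, y}.
            c {x, z} \<noteq> c {x, y} \<and> c {y, z} \<noteq> c {x, y} \<and> c {y, z} \<noteq> c {x, z}}))"
proof -
  let ?S = "{..<q}"
  \<comment> \<open>All subsets are coloured, so \<open>c {x, y} < q\<close> also holds for
    \<open>x = y\<close>; the proportions concerning pairs are unaffected.\<close>
  let ?K = "Pow {..<n}"
  let ?\<Omega> = "?K \<rightarrow>\<^sub>E ?S"
  let ?I = "\<lambda>x y. {..<n} - {x, y}"
  let ?A = "\<lambda>x y (c :: nat set \<Rightarrow> nat) z. - {c {x, y}}"
  \<comment> \<open>The value \<open>{}\<close> rules out a hit when the first condition on
    \<open>z\<close> fails, so the hits are exactly the rainbow triangles.\<close>
  let ?B = "\<lambda>x y c z. if c {x, z} \<noteq> c {x, y} then - {c {x, y}, c {x, z}} else {}"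
  let ?e = "exp (- \<epsilon>\<^sup>2 * (real n - 2) / 4)"
  define P where "P = {(x, y). x < n \<and> y < n \<and> x \<noteq> y}"
  \<comment> \<open>The two conditions on \<open>z\<close> are exposed one after the other: first the colour of \<open>{x, z}\<close>, then,
    conditionally on it, the colour of \<open>{y, z}\<close>.\<close>
  define tailA where "tailA x y c \<longleftrightarrow> real (card {z \<in> ?I x y. c {x, z} \<in> ?A x y c z})
    < (\<Sum>z\<in>?I x y. real (card (?S \<inter> ?A x y c z)) / real (card ?S)) - \<epsilon> * real (card (?I x y))" for x y c
  define tailB where "tailB x y c \<longleftrightarrow> real (card {z \<in> ?I x y. c {y, z} \<in> ?B x y c z})
    < (\<Sum>z\<in>?I x y. real (card (?S \<inter> ?B x y c z)) / real (card ?S)) - \<epsilon> * real (card (?I x y))" for x y c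
  define bad where "bad p c \<longleftrightarrow> (case p of (x, y) \<Rightarrow> tailA x y c \<or> tailB x y c)" for p c
  have S: "finite ?S" "?S \<noteq> {}" using q by (auto simp: lessThan_empty_iff)
  have fin: "finite ?\<Omega>" by (simp add: finite_PiE)
  have P_sub: "P \<subseteq> {..<n} \<times> {..<n}" by (auto simp: P_def)
  have "card P \<le> n * n" using card_mono[OF _ P_sub] by simp
  then have cardP: "real (card P) \<le> (real n)\<^sup>2"
    by (metis of_nat_le_iff of_nat_mult power2_eq_square)
  have cardI: "real (card (?I x y)) = real n - 2" if "(x, y) \<in> P" for x y
    using that n by (auto simp: P_def card_Diff_subset of_nat_diff)
  have inj: "inj_on (\<lambda>z. {x, z}) J" for x :: nat and J
    by (auto simp: inj_on_def doubleton_eq_iff)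
  have tailA: "real (card {c \<in> ?\<Omega>. tailA x y c}) \<le> ?e * real (card ?\<Omega>)" if "(x, y) \<in> P" for x y
  proof -
    have xy: "x < n" "y < n" "x \<noteq> y" using that by (auto simp: P_def)
    have "real (card {c \<in> ?\<Omega>. tailA x y c}) \<le> exp (- \<epsilon>\<^sup>2 * real (card (?I x y)) / 4) * real (card ?\<Omega>)"
      unfolding tailA_def
    proof (rule card_PiE_conditional_lower_tail_image[where \<phi> = "\<lambda>z. {x, z}" and B = "?A x y"])
      \<comment> \<open>The pair \<open>{x, y}\<close> is not among the exposed pairs
        \<open>{x, z}\<close>, since \<open>z\<close> differs from \<open>y\<close>.\<close>
      show "- {c {x, y}} = - {c' {x, y}}"
        if "\<And>e. e \<in> ?K - (\<lambda>z. {x, z}) ` ?I x y \<Longrightarrow> c e = c' e" for c c' :: "nat set \<Rightarrow> nat"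
        using that[of "{x, y}"] xy by (auto simp: doubleton_eq_iff)
    qed (use S xy eps inj in auto)
    then show ?thesis by (simp only: cardI[OF that])
  qed
  have tailB: "real (card {c \<in> ?\<Omega>. tailB x y c}) \<le> ?e * real (card ?\<Omega>)" if "(x, y) \<in> P" for x y
  proof -
    have xy: "x < n" "y < n" "x \<noteq> y" using that by (auto simp: P_def)
    have "real (card {c \<in> ?\<Omega>. tailB x y c}) \<le> exp (- \<epsilon>\<^sup>2 * real (card (?I x y)) / 4) * real (card ?\<Omega>)"
      unfolding tailB_def
    proof (rule card_PiE_conditional_lower_tail_image[where \<phi> = "\<lambda>z. {y, z}" and B = "?B x y"])
      show "?B x y c z = ?B x y c' z" if z: "z \<in> ?I x y"
        and eq: "\<And>e. e \<in> ?K - (\<lambda>z. {y, z}) ` ?I x y \<Longrightarrow> c e = c' e" for c c' :: "nat set \<Rightarrow> nat" and z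
      proof -
        \<comment> \<open>Neither \<open>{x, y}\<close> nor \<open>{x, z}\<close> has the form
          \<open>{y, w}\<close> with \<open>w\<close> outside \<open>{x, y}\<close>, so both colours
          are fixed before this exposure.\<close>
        have "c {x, y} = c' {x, y}" "c {x, z} = c' {x, z}"
          using xy z by (auto intro!: eq simp: doubleton_eq_iff)
        then show ?thesis by simp
      qed
    qed (use S xy eps inj in auto)
    then show ?thesis by (simp only: cardI[OF that])
  qed
  have "\<exists>c\<in>?\<Omega>. \<forall>p\<in>P. \<not> bad p c"
  proof (rule ex_avoiding_all)
    show "real (card {c \<in> ?\<Omega>. bad p c}) \<le> (2 * ?e) * real (card ?\<Omega>)" if p: "p \<in> P" for p
    proof -
      obtain x y where xy: "p = (x, y)" "(x, y) \<in> P" using p by (cases p) auto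
      have "{c \<in> ?\<Omega>. bad p c} = {c \<in> ?\<Omega>. tailA x y c} \<union> {c \<in> ?\<Omega>. tailB x y c}"
        by (auto simp: bad_def xy)
      then have "card {c \<in> ?\<Omega>. bad p c} \<le> card {c \<in> ?\<Omega>. tailA x y c} + card {c \<in> ?\<Omega>. tailB x y c}"
        by (simp add: card_Un_le)
      then show ?thesis using tailA[OF xy(2)] tailB[OF xy(2)] by simp
    qed
    show "real (card P) * (2 * ?e) < 1"
      by (rule le_less_trans[OF mult_right_mono[OF cardP] small]) simp
    show "finite P" using P_sub finite_subset by blast
    show "?\<Omega> \<noteq> {}" using S by (simp add: PiE_eq_empty_iff)
  qed (rule fin)
  then obtain c where c: "c \<in> ?\<Omega>"
    and good: "\<And>x y. (x, y) \<in> P \<Longrightarrow> \<not> tailA x y c \<and> \<not> tailB x y c"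
    by (auto simp: bad_def)
  have cq: "c {x, y} < q" if "x < n" "y < n" for x y
    using PiE_mem[OF c, of "{x, y}"] that by auto
  have "((1 - 1 / real q) * (1 - 2 / real q) - 2 * \<epsilon>) * (real n - 2)
       \<le> real (card {z \<in> ?I x y. c {x, z} \<noteq> c {x, y} \<and> c {y, z} \<noteq> c {x, y} \<and> c {y, z} \<noteq> c {x, z}})"
    if xy: "x < n" "y < n" "x \<noteq> y" for x y
  proof -
    have P: "(x, y) \<in> P" using xy by (simp add: P_def)
    let ?Z = "{z \<in> ?I x y. c {x, z} \<noteq> c {x, y}}"
    have cA: "real (card (?S \<inter> - {c {x, y}})) / real q = 1 - 1 / real q"
    proof -
      have "card (?S \<inter> - {c {x, y}}) = q - 1"
        using cq[OF xy(1,2)] by (simp add: Diff_eq[symmetric])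
      then show ?thesis using q by (simp add: of_nat_diff field_simps)
    qed
    have "\<not> real (card ?Z) < (real n - 2) * (1 - 1 / real q) - \<epsilon> * (real n - 2)"
      using good[OF P] unfolding tailA_def
      by (simp only: sum_constant cardI[OF P] card_lessThan cA) simp
    then have Z: "(1 - 1 / real q) * (real n - 2) - \<epsilon> * (real n - 2) \<le> real (card ?Z)"
      by (simp add: mult.commute)
    have cB: "real (card (?S \<inter> ?B x y c z)) / real q = (if c {x, z} \<noteq> c {x, y} then 1 - 2 / real q else 0)"
      if "z \<in> ?I x y" for z
    proof -
      have "card (?S \<inter> - {c {x, y}, c {x, z}}) = q - 2" if "c {x, z} \<noteq> c {x, y}"
        using cq[of x y] cq[of x z] xy that \<open>z \<in> ?I x y\<close>
        by (simp add: Diff_eq[symmetric] card_Diff_subset del: Diff_insert)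
      then show ?thesis using q by (simp add: of_nat_diff field_simps)
    qed
    have "(\<Sum>z\<in>?I x y. real (card (?S \<inter> ?B x y c z)) / real (card ?S))
        = (\<Sum>z\<in>?I x y. if c {x, z} \<noteq> c {x, y} then 1 - 2 / real q else 0)"
      using cB by (intro sum.cong) auto
    also have "\<dots> = (1 - 2 / real q) * real (card ?Z)"
      by (subst sum.inter_filter[symmetric]) auto
    finally have sB: "(\<Sum>z\<in>?I x y. real (card (?S \<inter> ?B x y c z)) / real (card ?S))
        = (1 - 2 / real q) * real (card ?Z)" .
    have "{z \<in> ?I x y. c {y, z} \<in> ?B x y c z}
        = {z \<in> ?I x y. c {x, z} \<noteq> c {x, y} \<and> c {y, z} \<noteq> c {x, y} \<and> c {y, z} \<noteq> c {x, z}}" (is "_ = ?R")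
      by auto
    then have R: "(1 - 2 / real q) * real (card ?Z) - \<epsilon> * (real n - 2) \<le> real (card ?R)"
      using good[OF P] unfolding tailB_def sB cardI[OF P] by simp
    \<comment> \<open>The error of the first exposure is multiplied by \<open>1 - 2 / q\<close>. As
      this factor lies between 0 and 1, the error does not grow.\<close>
    have t: "0 \<le> 1 - 2 / real q" "1 - 2 / real q \<le> 1" using q by auto
    have "(1 - 2 / real q) * (\<epsilon> * (real n - 2)) \<le> 1 * (\<epsilon> * (real n - 2))"
      using t eps n by (intro mult_right_mono) auto
    moreover have "(1 - 2 / real q) * ((1 - 1 / real q) * (real n - 2) - \<epsilon> * (real n - 2))
        \<le> (1 - 2 / real q) * real (card ?Z)"
      using t Z by (intro mult_left_mono) auto
    moreover have "(u * t - 2 * \<epsilon>) * k = t * (u * k - \<epsilon> * k) + t * (\<epsilon> * k) - 2 * (\<epsilon> * k)" for t u k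
      by (simp add: algebra_simps)
    ultimately show ?thesis using R by simp
  qed
  then show ?thesis using cq by blast
qed

section \<open>The rainbow 3-graph of a colouring and the lower bound\<close>

definition rainbow_graph :: "('a set \<Rightarrow> 'c) \<Rightarrow> 'a set \<Rightarrow> 'a hgraph" where
  "rainbow_graph c V = (V, {e. e \<subseteq> V \<and> card e = 3 \<and> inj_on c {p. p \<subseteq> e \<and> card p = 2}})"

lemma graph3_rainbow_graph: "finite V \<Longrightarrow> graph3 (rainbow_graph c V)"
  by (auto simp: uniform_graph_def rainbow_graph_def)

lemma rainbow_graph_linkD:
  assumes "{x, y, z} \<in> edges (rainbow_graph c V)"
  shows "c {x, y} \<noteq> c {x, z}"
proof
  assume eq: "c {x, y} = c {x, z}"
  have ne: "x \<noteq> y \<and> x \<noteq> z \<and> y \<noteq> z" and "inj_on c {p. p \<subseteq> {x, y, z} \<and> card p = 2}"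
    using assms card_triple_eq_3_iff[of x y z] by (auto simp: rainbow_graph_def)
  then have "{x, y} = {x, z}" using inj_onD[of c _ "{x, y}" "{x, z}"] eq by auto
  then show False using ne by (auto simp: doubleton_eq_iff)
qed

lemma rainbow_graph_edgeI:
  assumes "x \<in> V" "y \<in> V" "z \<in> V" "x \<noteq> y" "x \<noteq> z" "y \<noteq> z"
    and "c {x, y} \<noteq> c {x, z}" "c {y, z} \<noteq> c {x, y}" "c {y, z} \<noteq> c {x, z}"
  shows "{x, y, z} \<in> edges (rainbow_graph c V)"
proof -
  have "{p. p \<subseteq> {x, y, z} \<and> card p = 2} \<subseteq> {{x, y}, {x, z}, {y, z}}"
  proof
    fix p assume "p \<in> {p. p \<subseteq> {x, y, z} \<and> card p = 2}"
    then obtain a b where "p = {a, b}" "a \<noteq> b" "p \<subseteq> {x, y, z}" by (auto simp: card_2_iff)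
    then show "p \<in> {{x, y}, {x, z}, {y, z}}" by (auto simp: insert_commute)
  qed
  moreover have "inj_on c {{x, y}, {x, z}, {y, z}}" using assms by auto
  ultimately have "inj_on c {p. p \<subseteq> {x, y, z} \<and> card p = 2}" by (rule inj_on_subset[rotated])
  then show ?thesis using assms by (simp add: rainbow_graph_def card_triple_eq_3_iff)
qed

text \<open>If \<open>x\<close> is the apex of a copy, any two of the \<open>s\<close> other
  vertices form an edge with \<open>x\<close>. Their pairs with \<open>x\<close> therefore have
  \<open>s\<close> distinct colours, more than \<open>C\<close> contains.\<close>

lemma not_contains3_rainbow_graph:
  assumes "\<And>x y. x \<in> V \<Longrightarrow> y \<in> V \<Longrightarrow> c {x, y} \<in> C" "finite C" "card C < s"
  shows "\<not> contains3 (rainbow_graph c V) (suspension (complete_graph2 s))"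
proof
  let ?F = "suspension (complete_graph2 s)"
  assume "contains3 (rainbow_graph c V) ?F"
  then obtain H f where H: "verts H \<subseteq> V" "edges H \<subseteq> edges (rainbow_graph c V)"
    and f: "bij_betw f (verts ?F) (verts H)" "edges H = (\<lambda>e. f ` e) ` edges ?F"
    by (auto simp: contains3_def subgraph3_def hg_iso_def rainbow_graph_def)
  define x y where "x = f None" and "y = (\<lambda>i. f (Some i))"
  have "f v \<in> V" if "v \<in> verts ?F" for v using bij_betwE[OF f(1)] H(1) that by blast
  then have V: "x \<in> V" "\<And>i. i < s \<Longrightarrow> y i \<in> V"
    by (auto simp: x_def y_def suspension_def complete_graph2_def)
  have "inj_on (\<lambda>i. c {x, y i}) {..<s}"
  proof (rule inj_onI, rule ccontr)
    fix i j assume ij: "i \<in> {..<s}" "j \<in> {..<s}" "c {x, y i} = c {x, y j}" "i \<noteq> j"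
    then have "{i, j} \<in> edges (complete_graph2 s)" by (auto simp: complete_graph2_def)
    then have "insert None (Some ` {i, j}) \<in> edges ?F"
      unfolding suspension_def snd_conv by (rule imageI)
    then have "f ` insert None (Some ` {i, j}) \<in> edges H" unfolding f(2) by (rule imageI)
    then have "{x, y i, y j} \<in> edges (rainbow_graph c V)" using H(2) by (auto simp: x_def y_def)
    then show False using rainbow_graph_linkD ij(3) by metis
  qed
  moreover have "(\<lambda>i. c {x, y i}) ` {..<s} \<subseteq> C" using V assms(1) by auto
  ultimately have "card {..<s} \<le> card C" using assms(2) by (rule card_inj_on_le)
  then show False using assms(3) by simp
qed

lemma coex_suspension_complete_ge:
  fixes \<epsilon> :: real and s n :: nat
  assumes s: "3 \<le> s" and n: "2 \<le> n" and eps: "0 \<le> \<epsilon>"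
    and small: "(real n)\<^sup>2 * (2 * exp (- \<epsilon>\<^sup>2 * (real n - 2) / 4)) < 1"
  shows "((1 - 1 / (real s - 1)) * (1 - 2 / (real s - 1)) - 2 * \<epsilon>) * (real n - 2)
    \<le> real (coex n {suspension (complete_graph2 s)})"
proof -
  define t where "t = ((1 - 1 / (real s - 1)) * (1 - 2 / (real s - 1)) - 2 * \<epsilon>) * (real n - 2)"
  have q: "real (s - 1) = real s - 1" using s by (simp add: of_nat_diff)
  obtain c :: "nat set \<Rightarrow> nat" where c: "\<And>x y. x < n \<Longrightarrow> y < n \<Longrightarrow> c {x, y} < s - 1"
    and many: "\<And>x y. x < n \<Longrightarrow> y < n \<Longrightarrow> x \<noteq> y \<Longrightarrow>
       t \<le> real (card {z \<in> {..<n} - {x, y}.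
            c {x, z} \<noteq> c {x, y} \<and> c {y, z} \<noteq> c {x, y} \<and> c {y, z} \<noteq> c {x, z}})"
  proof -
    \<comment> \<open>With \<open>q = s - 1\<close> colours, one too few for a suspended
      \<open>K_s\<close>; \<open>s \<ge> 3\<close> ensures the two colours that the random colouring
      requires.\<close>
    have "2 \<le> s - 1" using s by simp
    from ex_colouring_many_rainbow_triangles[OF this n eps small, unfolded q, folded t_def] that
    show ?thesis by blast
  qed
  let ?G = "rainbow_graph c {..<n}"
  have "nat \<lceil>t\<rceil> \<le> coex n {suspension (complete_graph2 s)}"
  proof (rule coex_greatest)
    show G: "graph3 ?G" by (simp add: graph3_rainbow_graph)
    show "card (verts ?G) = n" by (simp add: rainbow_graph_def)
    show "\<not> contains3 ?G F" if "F \<in> {suspension (complete_graph2 s)}" for F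
      using not_contains3_rainbow_graph[of "{..<n}" c "{..<s - 1}" s] c s that by auto
    fix x y assume "x \<in> verts ?G" "y \<in> verts ?G" and ne: "x \<noteq> y"
    then have xy: "x < n" "y < n" by (auto simp: rainbow_graph_def)
    let ?R = "{z \<in> {..<n} - {x, y}.
            c {x, z} \<noteq> c {x, y} \<and> c {y, z} \<noteq> c {x, y} \<and> c {y, z} \<noteq> c {x, z}}"
    have "?R \<subseteq> {z. {x, y, z} \<in> edges ?G}"
      using xy ne rainbow_graph_edgeI[of x "{..<n}" y _ c] by fastforce
    moreover have "finite {z. {x, y, z} \<in> edges ?G}"
      by (rule finite_subset[of _ "{..<n}"]) (auto simp: rainbow_graph_def)
    ultimately have "card ?R \<le> codegree ?G x y"
      unfolding codegree_conv_card_third_vertex[OF G ne] by (rule card_mono[rotated])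
    then show "nat \<lceil>t\<rceil> \<le> codegree ?G x y"
      using many[OF xy ne] by (simp add: nat_le_iff ceiling_le_iff)
  qed (rule n)
  then show ?thesis by (simp add: nat_le_iff ceiling_le_iff t_def)
qed

theorem corollary13:
  fixes s :: nat
  assumes "s \<ge> 2"
  shows "codegree_density (suspension (complete_graph2 s))
           \<ge> (1 - 1 / (real s - 1)) * (1 - 2 / (real s - 1))"
proof -
  let ?\<F> = "{suspension (complete_graph2 s)}"
  let ?t = "(1 - 1 / (real s - 1)) * (1 - 2 / (real s - 1))"
  have lim: "(\<lambda>n. real (coex n ?\<F>) / (real n - 2)) \<longlonglongrightarrow> codegree_density (suspension (complete_graph2 s))"
    unfolding codegree_density_def
    using suspension_complete_nonempty[OF assms] by (intro codegree_density_family_LIMSEQ) simp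
  show ?thesis
  proof (cases "s = 2")
    case True
    \<comment> \<open>For \<open>s = 2\<close> the factor \<open>1 - 1 / (s - 1)\<close> vanishes,
      so nonnegativity is all that is claimed.\<close>
    have "0 \<le> codegree_density (suspension (complete_graph2 s))"
      by (rule LIMSEQ_le_const[OF lim]) (auto intro!: exI[of _ 2])
    then show ?thesis using True by simp
  next
    case False
    show ?thesis
    proof (rule field_le_epsilon)
      fix e :: real assume "0 < e"
      \<comment> \<open>The colouring loses \<open>2 * \<epsilon>\<close> in the density.\<close>
      define \<epsilon> where "\<epsilon> = e / 2"
      have eps: "0 < \<epsilon>" using \<open>0 < e\<close> by (simp add: \<epsilon>_def)
      obtain N where N: "\<And>n. n \<ge> N \<Longrightarrow> (real n)\<^sup>2 * exp (- (\<epsilon>\<^sup>2 / 4) * (real n - 2)) < 1 / 2"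
        using eventually_square_times_exp_less[of "\<epsilon>\<^sup>2 / 4" "1 / 2"] eps by auto
      have "?t - 2 * \<epsilon> \<le> codegree_density (suspension (complete_graph2 s))"
      proof (rule LIMSEQ_le_const[OF lim], intro exI allI impI)
        fix n assume n: "max N 3 \<le> n"
        have "(?t - 2 * \<epsilon>) * (real n - 2) \<le> real (coex n ?\<F>)"
          using N[of n] n eps False assms by (intro coex_suspension_complete_ge) auto
        then show "?t - 2 * \<epsilon> \<le> real (coex n ?\<F>) / (real n - 2)"
          using n by (simp add: pos_le_divide_eq)
      qed
      then show "?t \<le> codegree_density (suspension (complete_graph2 s)) + e"
        by (simp add: \<epsilon>_def)
    qed
  qed
qed

end
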